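(* Let $\Gamma$ be a simplicial complex on a finite ground set and let $F_1,\dots,F_k$ be an ordering of the facets of $\Gamma$ that satisfies the running intersection property (RIP). Let $A=A^{1,\dots,k}$ be the multipartition matrix representing the binary hierarchical model on $\Gamma$, with partitions $A^1,\dots,A^k$ corresponding to $F_1,\dots,F_k$ in this order. Then $A$ satisfies the generalized running intersection property (GRIP).
   Context: Write $[r]=\{1,\dots,r\}$. A simplicial complex on ground set $[n]$ is a family of subsets of $[n]$ closed under taking subsets; its facets are its inclusion-maximal elements. RIP: an ordering $F_1,\dots,F_k$ of the facets satisfies the running intersection property if for each $r\in[k-1]$ there is $k_r\in[r]$ such that $\left(\bigcup_{i=1}^{r}F_i\right)\cap F_{r+1}=F_{k_r}\cap F_{r+1}$. Matrix of the binary hierarchical model: the columns of $A$ are indexed by the subsets $T\subset[n]$. The partition $A^i$ has $2^{|F_i|}$ rows $a^i_S$ indexed by subsets $S\subset F_i$, with $a^i_S(T)=1$ if $T\cap F_i=S$ and $a^i_S(T)=0$ otherwise. Partition and multipartition matrices: a partition matrix with $m$ columns is a $0/1$ matrix each of whose columns has exactly one entry equal to $1$, with no zero rows. A multipartition matrix $A=A^{1,\dots,k}$ is the stacking of partition matrices $A^1,\dots,A^k$ with $m$ columns. Let $a^\ell_i$ denote the rows of $A^\ell$ and $I^\ell_i$ the support of $a^\ell_i$. $A^{1,\dots,\ell}$ is the stacking of the first $\ell$ partitions, and $c^\ell_j$ the number of columns of $A^{1,\dots,\ell}$ equal to its $j$-th column (the $j$-th included). Well-connected: $A$ is well-connected if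 for every row $a^\ell_u$ with $\ell>1$ one has $c^\ell_j/c^{\ell-1}_j=c^\ell_{j'}/c^{\ell-1}_{j'}$ for all $j,j'\in I^\ell_u$. The matrix $\Cup_{n=1}^{\ell}A^n$: let $\beta$ be the number of distinct columns of $A^{1,\dots,\ell}$ and $\lambda$ a surjective labeling of the columns by $[\beta]$ with $\lambda(j)=\lambda(j')$ iff the $j$-th and $j'$-th columns of $A^{1,\dots,\ell}$ are equal. Then $\Cup_{n=1}^{\ell}A^n$ is the $\beta\times m$ partition matrix whose $j$-th column is the standard basis vector $e_{\lambda(j)}$. Florets: let $B,C$ be partition matrices with $m$ columns; $BC$ denotes $B$ stacked above $C$ (a multipartition matrix with two partitions). A row of $B$ and a row of $C$ are connected if their supports intersect. $BC$ satisfies the floret condition if for any two rows of $B$, the sets of rows of $C$ connected to them are disjoint or equal. In that case the set of rows of $C$ connected to a given row of $B$ is a floret of $C$; let $\mathcal{F}^C_1,\dots,\mathcal{F}^C_f$ be the distinct florets of $C$. $B\Cap C$ is the $f\times m$ matrix whose $(t,j)$ entry is $1$ if the row of $C$ having $j$ in its support lies in $\mathcal{F}^C_t$, and $0$ otherwise. GRIP: with $B_\ell=\Cup_{n=1}^{\ell}A^n$, the matrix $A^{1,\dots,k}$ satisfies the GRIP if for each $\ell\in[k-1]$: (1) $B_\ell A^{\ell+1}$ is well-connected; (2) $B_\ell A^{\ell+1}$ satisfies the floret condition; (3) the rows of $B_\ell\Cap A^{\ell+1}$ lie in the rowspan of $A^{1,\dots,\ell}$. *)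

theory Defs
  imports "Jordan_Normal_Form.VS_Connect"
begin

section \<open>Simplicial complexes and the running intersection property\<close>

definition simplicial_complex :: "'v set \<Rightarrow> 'v set set \<Rightarrow> bool" where
  "simplicial_complex V \<Gamma> \<longleftrightarrow> \<Gamma> \<subseteq> Pow V \<and> (\<forall>F\<in>\<Gamma>. \<forall>G. G \<subseteq> F \<longrightarrow> G \<in> \<Gamma>)"

definition facets :: "'v set set \<Rightarrow> 'v set set" where
  "facets \<Gamma> = {F \<in> \<Gamma>. \<forall>G\<in>\<Gamma>. F \<subseteq> G \<longrightarrow> G = F}"

definition facet_ordering :: "'v set set \<Rightarrow> 'v set list \<Rightarrow> bool" where
  "facet_ordering \<Gamma> Fs \<longleftrightarrow> distinct Fs \<and> set Fs = facets \<Gamma>"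

text \<open>Lists are indexed from 0, so \<open>Fs ! i\<close> is the facet usually written \<open>F\<close> with subscript \<open>i + 1\<close>.
  The same shift applies to lists of partition matrices below.\<close>

definition RIP :: "'v set list \<Rightarrow> bool" where
  "RIP Fs \<longleftrightarrow> (\<forall>r. 1 \<le> r \<and> r < length Fs \<longrightarrow>
     (\<exists>q<r. (\<Union>i<r. Fs ! i) \<inter> Fs ! r = Fs ! q \<inter> Fs ! r))"


section \<open>Partition and multipartition matrices\<close>

definition partition_matrix :: "nat \<Rightarrow> real mat \<Rightarrow> bool" where
  "partition_matrix m M \<longleftrightarrow> dim_col M = m \<and>
     (\<forall>i<dim_row M. \<forall>j<m. M $$ (i, j) \<in> {0, 1}) \<and>
     (\<forall>j<m. \<exists>!i. i < dim_row M \<and> M $$ (i, j) = 1) \<and>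
     (\<forall>i<dim_row M. row M i \<noteq> 0\<^sub>v m)"

text \<open>A multipartition matrix is given by the list of its partitions; the matrix itself
  is obtained with \<open>stack\<close>. The number \<open>m\<close> of columns is passed explicitly because
  the list may be empty.\<close>

definition multipartition :: "nat \<Rightarrow> real mat list \<Rightarrow> bool" where
  "multipartition m As \<longleftrightarrow> (\<forall>M\<in>set As. partition_matrix m M)"

definition stack :: "nat \<Rightarrow> real mat list \<Rightarrow> real mat" where
  "stack m As = mat_of_rows m (concat (map rows As))"

definition supp :: "real mat \<Rightarrow> nat \<Rightarrow> nat set" where
  "supp M u = {j. j < dim_col M \<and> M $$ (u, j) \<noteq> 0}"

definition col_mult :: "real mat \<Rightarrow> nat \<Rightarrow> nat" where
  "col_mult M j = card {j'. j' < dim_col M \<and> col M j' = col M j}"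

definition well_connected :: "nat \<Rightarrow> real mat list \<Rightarrow> bool" where
  "well_connected m As \<longleftrightarrow> (\<forall>l u. 1 \<le> l \<and> l < length As \<and> u < dim_row (As ! l) \<longrightarrow>
     (\<forall>j\<in>supp (As ! l) u. \<forall>j'\<in>supp (As ! l) u.
        real (col_mult (stack m (take (Suc l) As)) j) / real (col_mult (stack m (take l As)) j) =
        real (col_mult (stack m (take (Suc l) As)) j') / real (col_mult (stack m (take l As)) j')))"


subsection \<open>The matrix \<open>\<Cup>\<close>\<close>

definition num_distinct_cols :: "real mat \<Rightarrow> nat" where
  "num_distinct_cols M = card (set (cols M))"

definition col_labeling :: "real mat \<Rightarrow> (nat \<Rightarrow> nat) \<Rightarrow> bool" where
  "col_labeling M lab \<longleftrightarrow> lab ` {..<dim_col M} = {..<num_distinct_cols M} \<and>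
     (\<forall>j<dim_col M. \<forall>j'<dim_col M. lab j = lab j' \<longleftrightarrow> col M j = col M j')"

definition Cup_mat :: "real mat \<Rightarrow> (nat \<Rightarrow> nat) \<Rightarrow> real mat" where
  "Cup_mat M lab = mat (num_distinct_cols M) (dim_col M) (\<lambda>(i, j). if lab j = i then 1 else 0)"

lemma ex_col_labeling: "\<exists>lab. col_labeling M lab"
proof -
  have "finite (set (cols M))" by simp
  then obtain f where f: "bij_betw f (set (cols M)) {..<card (set (cols M))}"
    using finite_same_card_bij[of "set (cols M)" "{..<card (set (cols M))}"] by auto
  have s: "set (cols M) = col M ` {..<dim_col M}"
    by (auto simp: cols_def)
  have "(f \<circ> col M) ` {..<dim_col M} = {..<num_distinct_cols M}"
    using f unfolding bij_betw_def num_distinct_cols_def s by (simp add: image_comp)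
  moreover have "inj_on f (col M ` {..<dim_col M})"
    using f unfolding bij_betw_def s by simp
  ultimately have "col_labeling M (f \<circ> col M)"
    unfolding col_labeling_def by (auto dest: inj_onD)
  then show ?thesis by blast
qed


subsection \<open>Florets and the matrix \<open>\<Cap>\<close>\<close>

definition connected_rows :: "real mat \<Rightarrow> real mat \<Rightarrow> nat \<Rightarrow> nat set" where
  "connected_rows B C u = {v. v < dim_row C \<and> supp B u \<inter> supp C v \<noteq> {}}"

definition floret_condition :: "real mat \<Rightarrow> real mat \<Rightarrow> bool" where
  "floret_condition B C \<longleftrightarrow> (\<forall>u<dim_row B. \<forall>u'<dim_row B.
     connected_rows B C u \<inter> connected_rows B C u' = {} \<or>
     connected_rows B C u = connected_rows B C u')"

definition florets :: "real mat \<Rightarrow> real mat \<Rightarrow> nat set set" where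
  "florets B C = connected_rows B C ` {..<dim_row B}"

definition floret_ordering :: "real mat \<Rightarrow> real mat \<Rightarrow> nat set list \<Rightarrow> bool" where
  "floret_ordering B C fl \<longleftrightarrow> distinct fl \<and> set fl = florets B C"

definition Cap_mat :: "real mat \<Rightarrow> nat set list \<Rightarrow> real mat" where
  "Cap_mat C fl = mat (length fl) (dim_col C)
     (\<lambda>(t, j). if \<exists>v \<in> fl ! t. j \<in> supp C v then 1 else 0)"

lemma ex_floret_ordering: "\<exists>fl. floret_ordering B C fl"
  using finite_distinct_list[of "florets B C"]
  by (auto simp: floret_ordering_def florets_def)


section \<open>The generalized running intersection property\<close>

text \<open>The matrices \<open>\<Cup>\<close> and \<open>\<Cap>\<close> are only determined up to a permutation of their rows,
  namely by a labeling of the distinct columns and by an ordering of the florets. The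
  conditions are required for all such choices, which exist by \<open>ex_col_labeling\<close>
  and \<open>ex_floret_ordering\<close>.\<close>

definition GRIP :: "nat \<Rightarrow> real mat list \<Rightarrow> bool" where
  "GRIP m As \<longleftrightarrow> multipartition m As \<and>
     (\<forall>l lab. 1 \<le> l \<and> l < length As \<and> col_labeling (stack m (take l As)) lab \<longrightarrow>
       (let B = Cup_mat (stack m (take l As)) lab; C = As ! l in
          well_connected m [B, C] \<and>
          floret_condition B C \<and>
          (\<forall>fl. floret_ordering B C fl \<longrightarrow>
             set (rows (Cap_mat C fl)) \<subseteq> vec_space.row_space m (stack m (take l As)))))"


section \<open>The binary hierarchical model\<close>

text \<open>Columns and rows of the model are indexed by sets. The bijections \<open>cs\<close> and \<open>rs\<close>
  enumerate these index sets.\<close>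

definition hierarchical_partition ::
    "'v set \<Rightarrow> (nat \<Rightarrow> 'v set) \<Rightarrow> 'v set \<Rightarrow> (nat \<Rightarrow> 'v set) \<Rightarrow> real mat" where
  "hierarchical_partition V cs F rs = mat (2 ^ card F) (2 ^ card V)
     (\<lambda>(i, j). if cs j \<inter> F = rs i then 1 else 0)"

definition hierarchical_model :: "'v set \<Rightarrow> 'v set list \<Rightarrow> real mat list \<Rightarrow> bool" where
  "hierarchical_model V Fs As \<longleftrightarrow> length As = length Fs \<and>
     (\<exists>cs. bij_betw cs {..<2 ^ card V} (Pow V) \<and>
       (\<forall>i<length Fs. \<exists>rs. bij_betw rs {..<2 ^ card (Fs ! i)} (Pow (Fs ! i)) \<and>
          As ! i = hierarchical_partition V cs (Fs ! i) rs))"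

end

theory Submission
  imports Defs
begin

text \<open>Identify columns with subsets \<open>T\<close> of \<open>V\<close>, and let \<open>U\<close> be the union of the first \<open>l\<close> facets
  and \<open>F\<close> the next facet. Two columns of the first \<open>l\<close> partitions agree iff they have the same trace
  on \<open>U\<close>, so all multiplicities are powers of two depending only on \<open>U\<close> and \<open>F\<close>. The row of \<open>\<Cup>\<close>
  given by a trace \<open>S\<close> is connected to the rows of the next partition whose index has trace
  \<open>S \<inter> F\<close> on \<open>U\<close>, so florets correspond to traces on \<open>U \<inter> F\<close>. By RIP, \<open>U \<inter> F = F' \<inter> F\<close>
  for an earlier facet \<open>F'\<close>; hence a row of \<open>\<Cap>\<close> is the sum of the rows of the partition of \<open>F'\<close>
  whose index has a prescribed trace on \<open>F\<close>.\<close>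

section \<open>Stacked matrices: rows, columns and row spaces\<close>

lemma dim_col_stack [simp]: "dim_col (stack m Ms) = m"
  by (simp add: stack_def)

lemma rows_stack:
  assumes "\<forall>M\<in>set Ms. dim_col M = m"
  shows "rows (stack m Ms) = concat (map rows Ms)"
  unfolding stack_def
  by (rule rows_mat_of_rows) (use assms in \<open>auto simp: rows_def\<close>)

lemma col_eq_iff_rows:
  assumes "j < dim_col M" "j' < dim_col M"
  shows "col M j = col M j' \<longleftrightarrow> (\<forall>r\<in>set (rows M). r $ j = r $ j')"
  using assms by (auto simp: vec_eq_iff rows_def)

text \<open>The rows of a stack are the rows of its blocks, so comparing two columns entry by entry
  splits into comparisons block by block.\<close>

lemma col_stack_eq_iff:
  assumes "\<forall>M\<in>set Ms. dim_col M = m" "j < m" "j' < m"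
  shows "col (stack m Ms) j = col (stack m Ms) j' \<longleftrightarrow> (\<forall>M\<in>set Ms. col M j = col M j')"
  using assms by (auto simp: col_eq_iff_rows rows_stack)

lemma row_space_subset_stack:
  fixes Ms :: "real mat list"
  assumes "\<forall>M\<in>set Ms. dim_col M = m" "M \<in> set Ms"
  shows "vec_space.row_space m M \<subseteq> vec_space.row_space m (stack m Ms)"
proof -
  interpret vec_space "TYPE(real)" m .
  show ?thesis
    unfolding row_space_def rows_stack[OF assms(1)]
    by (rule span_is_monotone) (use assms(2) in auto)
qed

section \<open>Supports and columns of \<open>Cup_mat\<close>\<close>

lemma dim_Cup_mat [simp]:
  "dim_row (Cup_mat M lab) = num_distinct_cols M" "dim_col (Cup_mat M lab) = dim_col M"
  by (simp_all add: Cup_mat_def)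

lemma supp_Cup_mat:
  "u < num_distinct_cols M \<Longrightarrow> supp (Cup_mat M lab) u = {j. j < dim_col M \<and> lab j = u}"
  by (auto simp: supp_def Cup_mat_def split: if_splits)

text \<open>Column \<open>j\<close> is the unit vector at position \<open>lab j\<close>, so equality
  of columns means equality of labels, which a labeling ties to equality of columns of
  \<open>M\<close>.\<close>

lemma col_Cup_mat_eq_iff:
  assumes "col_labeling M lab" "j < dim_col M" "j' < dim_col M"
  shows "col (Cup_mat M lab) j = col (Cup_mat M lab) j' \<longleftrightarrow> col M j = col M j'"
proof -
  have "lab j \<in> lab ` {..<dim_col M}"
    using assms(2) by simp
  then have "lab j < num_distinct_cols M"
    using assms(1) by (simp add: col_labeling_def)
  \<comment> \<open>At coordinate \<open>lab j\<close>, which surjectivity of the labeling keeps in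
    range, column \<open>j\<close> has entry 1, and column \<open>j'\<close> does so only if its
    label is the same.\<close>
  then have "col (Cup_mat M lab) j $ lab j = col (Cup_mat M lab) j' $ lab j \<longleftrightarrow> lab j = lab j'"
    using assms(2,3) by (simp add: Cup_mat_def)
  moreover have "col (Cup_mat M lab) j = col (Cup_mat M lab) j'" if "lab j = lab j'"
    using that assms(2,3) by (intro eq_vecI) (simp_all add: Cup_mat_def)
  ultimately have "col (Cup_mat M lab) j = col (Cup_mat M lab) j' \<longleftrightarrow> lab j = lab j'"
    by metis
  then show ?thesis
    using assms by (simp add: col_labeling_def)
qed

section \<open>Rows and columns of the hierarchical model as subsets\<close>

lemma dim_hierarchical_partition [simp]:
  "dim_row (hierarchical_partition V cs F rs) = 2 ^ card F"
  "dim_col (hierarchical_partition V cs F rs) = 2 ^ card V"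
  by (simp_all add: hierarchical_partition_def)

lemma supp_hierarchical_partition:
  "u < 2 ^ card F \<Longrightarrow>
    supp (hierarchical_partition V cs F rs) u = {j. j < 2 ^ card V \<and> cs j \<inter> F = rs u}"
  by (auto simp: supp_def hierarchical_partition_def split: if_splits)

text \<open>The enumerations hidden in the existentials of \<open>hierarchical_model\<close> become
  parameters: \<open>cs\<close> for the columns, \<open>rs i\<close> for the rows of partition
  \<open>i\<close>.\<close>

locale indexed_hierarchical_model =
  fixes V :: "'v set" and Fs :: "'v set list" and As :: "real mat list"
    and cs :: "nat \<Rightarrow> 'v set" and rs :: "nat \<Rightarrow> nat \<Rightarrow> 'v set"
  assumes finite_ground: "finite V"
    and facet_subset: "i < length Fs \<Longrightarrow> Fs ! i \<subseteq> V"
    and length_As: "length As = length Fs"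
    and bij_cs: "bij_betw cs {..<2 ^ card V} (Pow V)"
    and bij_rs: "i < length Fs \<Longrightarrow> bij_betw (rs i) {..<2 ^ card (Fs ! i)} (Pow (Fs ! i))"
    and nth_As: "i < length Fs \<Longrightarrow> As ! i = hierarchical_partition V cs (Fs ! i) (rs i)"
begin

abbreviation ncols :: nat where "ncols \<equiv> 2 ^ card V"

abbreviation before :: "nat \<Rightarrow> 'v set" where "before l \<equiv> \<Union>i<l. Fs ! i"

lemma cs_subset: "j < ncols \<Longrightarrow> cs j \<subseteq> V"
  using bij_betwE[OF bij_cs] by auto

lemma ex_col:
  assumes "T \<subseteq> V" obtains j where "j < ncols" "cs j = T"
proof -
  have "T \<in> cs ` {..<ncols}"
    using assms bij_betw_imp_surj_on[OF bij_cs] by simp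
  then show thesis using that by blast
qed

lemma ex_row:
  assumes "i < length Fs" "S \<subseteq> Fs ! i"
  obtains u where "u < 2 ^ card (Fs ! i)" "rs i u = S"
proof -
  have "S \<in> rs i ` {..<2 ^ card (Fs ! i)}"
    using assms(2) bij_betw_imp_surj_on[OF bij_rs[OF assms(1)]] by simp
  then show thesis using that by blast
qed

lemma rs_subset: "i < length Fs \<Longrightarrow> u < 2 ^ card (Fs ! i) \<Longrightarrow> rs i u \<subseteq> Fs ! i"
  using bij_betwE[OF bij_rs] by auto

lemma rs_inj:
  "i < length Fs \<Longrightarrow> u < 2 ^ card (Fs ! i) \<Longrightarrow> u' < 2 ^ card (Fs ! i) \<Longrightarrow>
    rs i u = rs i u' \<Longrightarrow> u = u'"
  using bij_rs[of i] by (auto simp: bij_betw_def dest: inj_onD)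

text \<open>The 1 in column \<open>j\<close> sits in the row indexed by
  \<open>cs j \<inter> Fs ! i\<close>. A row is nonzero because its own index is a subset of
  \<open>V\<close> and hence also labels a column.\<close>

lemma partition_matrix_nth:
  assumes i: "i < length Fs"
  shows "partition_matrix ncols (As ! i)"
proof -
  let ?M = "hierarchical_partition V cs (Fs ! i) (rs i)"
  have entry: "?M $$ (u, j) = (if cs j \<inter> Fs ! i = rs i u then 1 else 0)"
    if "u < 2 ^ card (Fs ! i)" "j < ncols" for u j
    using that by (simp add: hierarchical_partition_def)
  have unique: "\<exists>!u. u < 2 ^ card (Fs ! i) \<and> ?M $$ (u, j) = 1" if "j < ncols" for j
  proof -
    obtain u where u: "u < 2 ^ card (Fs ! i)" "rs i u = cs j \<inter> Fs ! i"
      using ex_row[OF i, of "cs j \<inter> Fs ! i"] by blast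
    then have "?M $$ (u, j) = 1" using that by (simp add: entry)
    moreover have "u' = u" if "u' < 2 ^ card (Fs ! i)" "?M $$ (u', j) = 1" for u'
      using that u \<open>j < ncols\<close> rs_inj[OF i] by (auto simp: entry split: if_splits)
    ultimately show ?thesis using u(1) by blast
  qed
  have "row ?M u \<noteq> 0\<^sub>v ncols" if u: "u < 2 ^ card (Fs ! i)" for u
  proof -
    obtain j where j: "j < ncols" "cs j = rs i u"
      using ex_col[OF subset_trans[OF rs_subset[OF i u] facet_subset[OF i]]] by blast
    then have "row ?M u $ j = 1"
      using u rs_subset[OF i u] by (auto simp: entry)
    then show ?thesis using j by auto
  qed
  then show ?thesis
    using unique by (auto simp: partition_matrix_def nth_As[OF i] entry)
qed

section \<open>Traces: equality and multiplicity of columns, vectors in the row space\<close>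

lemma dim_col_As: "\<forall>M\<in>set As. dim_col M = ncols"
  using nth_As length_As by (auto simp: in_set_conv_nth)

lemma dim_col_take: "\<forall>M\<in>set (take l As). dim_col M = ncols"
  using dim_col_As by (blast dest: in_set_takeD)

lemma col_nth_eq_iff:
  assumes i: "i < length Fs" and j: "j < ncols" "j' < ncols"
  shows "col (As ! i) j = col (As ! i) j' \<longleftrightarrow> cs j \<inter> Fs ! i = cs j' \<inter> Fs ! i"
proof
  assume eq: "col (As ! i) j = col (As ! i) j'"
  obtain u where u: "u < 2 ^ card (Fs ! i)" "rs i u = cs j \<inter> Fs ! i"
    using ex_row[OF i, of "cs j \<inter> Fs ! i"] by blast
  \<comment> \<open>Row \<open>u\<close> is where column \<open>j\<close> has its 1; equality forces
    \<open>j'\<close> to have the same trace as row index.\<close>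
  have "col (As ! i) j $ u = col (As ! i) j' $ u" by (simp add: eq)
  then show "cs j \<inter> Fs ! i = cs j' \<inter> Fs ! i"
    using u j by (auto simp: nth_As[OF i] hierarchical_partition_def split: if_splits)
next
  assume "cs j \<inter> Fs ! i = cs j' \<inter> Fs ! i"
  then show "col (As ! i) j = col (As ! i) j'"
    using j by (auto simp: vec_eq_iff nth_As[OF i] hierarchical_partition_def)
qed

lemma col_stack_take_eq_iff:
  assumes l: "l \<le> length Fs" and j: "j < ncols" "j' < ncols"
  shows "col (stack ncols (take l As)) j = col (stack ncols (take l As)) j' \<longleftrightarrow>
    cs j \<inter> before l = cs j' \<inter> before l"
proof -
  have "set (take l As) = (!) As ` {..<l}"
    using l length_As by (simp add: nth_image lessThan_atLeast0)
  then have "col (stack ncols (take l As)) j = col (stack ncols (take l As)) j' \<longleftrightarrow>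
      (\<forall>i<l. cs j \<inter> Fs ! i = cs j' \<inter> Fs ! i)"
    using l j by (auto simp: col_stack_eq_iff[OF dim_col_take] col_nth_eq_iff)
  also have "\<dots> \<longleftrightarrow> cs j \<inter> before l = cs j' \<inter> before l"
    by blast
  finally show ?thesis .
qed

text \<open>Once the trace on \<open>W\<close> is prescribed, the part of the set outside
  \<open>W\<close> is free, so removing \<open>W\<close> is a bijection onto
  \<open>Pow (V - W)\<close>.\<close>

lemma card_same_trace:
  assumes "j < ncols"
  shows "card {j'. j' < ncols \<and> cs j' \<inter> W = cs j \<inter> W} = 2 ^ card (V - W)"
proof -
  let ?J = "{j'. j' < ncols \<and> cs j' \<inter> W = cs j \<inter> W}"
  have "inj_on (\<lambda>j'. cs j' - W) ?J"
  proof (rule inj_onI)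
    fix a b assume ab: "a \<in> ?J" "b \<in> ?J" "cs a - W = cs b - W"
    then have "cs a = cs b" by blast
    then show "a = b"
      using ab bij_cs by (auto simp: bij_betw_def dest: inj_onD)
  qed
  moreover have "(\<lambda>j'. cs j' - W) ` ?J = Pow (V - W)"
  proof
    show "(\<lambda>j'. cs j' - W) ` ?J \<subseteq> Pow (V - W)"
      using cs_subset by auto
    show "Pow (V - W) \<subseteq> (\<lambda>j'. cs j' - W) ` ?J"
    proof
      fix Y assume Y: "Y \<in> Pow (V - W)"
      then obtain j' where "j' < ncols" "cs j' = (cs j \<inter> W) \<union> Y"
        using cs_subset[OF assms] ex_col[of "(cs j \<inter> W) \<union> Y"] by blast
      then show "Y \<in> (\<lambda>j'. cs j' - W) ` ?J"
        using Y by (intro image_eqI[of _ _ j']) auto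
    qed
  qed
  ultimately have "bij_betw (\<lambda>j'. cs j' - W) ?J (Pow (V - W))"
    by (simp add: bij_betw_def)
  then have "card ?J = card (Pow (V - W))"
    by (rule bij_betw_same_card)
  then show ?thesis
    using finite_ground by (simp add: card_Pow)
qed

text \<open>The vector is the sum of the rows whose index lies in \<open>\<S>\<close>;
  \<open>?y\<close> is the coefficient vector of this sum.\<close>

lemma trace_in_row_space:
  assumes q: "q < length Fs"
  shows "vec ncols (\<lambda>j. if cs j \<inter> Fs ! q \<in> \<S> then 1 else 0) \<in> vec_space.row_space ncols (As ! q)"
proof -
  interpret vec_space "TYPE(real)" ncols .
  let ?n = "2 ^ card (Fs ! q) :: nat"
  let ?y = "vec ?n (\<lambda>i. if rs q i \<in> \<S> then 1 else 0) :: real vec"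
  have A: "As ! q \<in> carrier_mat ?n ncols"
    by (rule carrier_matI) (simp_all add: nth_As[OF q])
  have "(As ! q)\<^sup>T *\<^sub>v ?y = vec ncols (\<lambda>j. if cs j \<inter> Fs ! q \<in> \<S> then 1 else 0)"
  proof (rule eq_vecI)
    fix j assume "j < dim_vec (vec ncols (\<lambda>j. if cs j \<inter> Fs ! q \<in> \<S> then 1 else 0 :: real))"
    then have j: "j < ncols" by simp
    \<comment> \<open>Column \<open>j\<close> has its only nonzero entry in row \<open>i0\<close>,
      so the sum below collapses to one term.\<close>
    obtain i0 where i0: "i0 < ?n" "rs q i0 = cs j \<inter> Fs ! q"
      using ex_row[OF q, of "cs j \<inter> Fs ! q"] by blast
    have "((As ! q)\<^sup>T *\<^sub>v ?y) $ j = (\<Sum>i\<in>{0..<?n}. (As ! q) $$ (i, j) * ?y $ i)"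
      using A j by (simp add: scalar_prod_def)
    also have "\<dots> = (\<Sum>i\<in>{0..<?n}. if i = i0 then (if cs j \<inter> Fs ! q \<in> \<S> then 1 else 0) else 0)"
      using j i0 rs_inj[OF q]
      by (intro sum.cong) (auto simp: nth_As[OF q] hierarchical_partition_def)
    finally show "((As ! q)\<^sup>T *\<^sub>v ?y) $ j =
        vec ncols (\<lambda>j. if cs j \<inter> Fs ! q \<in> \<S> then 1 else 0) $ j"
      using i0(1) j by simp
  qed (use A in auto)
  then show ?thesis
    unfolding row_space_eq[OF A] using A by (auto intro!: bexI[of _ ?y])
qed

section \<open>The three conditions for a fixed \<open>l\<close> and a fixed labeling\<close>

context
  fixes l :: nat and lab :: "nat \<Rightarrow> nat"
  assumes l: "l < length Fs"
    and lab: "col_labeling (stack ncols (take l As)) lab"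
begin

abbreviation B :: "real mat" where "B \<equiv> Cup_mat (stack ncols (take l As)) lab"

abbreviation F :: "'v set" where "F \<equiv> Fs ! l"

lemma dim_col_B_C: "dim_col B = ncols" "dim_col (As ! l) = ncols"
  using l by (simp_all add: nth_As)

lemma dim_row_C: "dim_row (As ! l) = 2 ^ card F"
  using l by (simp add: nth_As)

lemma col_B_eq_iff:
  assumes "j < ncols" "j' < ncols"
  shows "col B j = col B j' \<longleftrightarrow> cs j \<inter> before l = cs j' \<inter> before l"
  using col_Cup_mat_eq_iff[OF lab, of j j'] col_stack_take_eq_iff[of l j j'] assms l by simp

lemma lab_eq_iff:
  assumes "j < ncols" "j' < ncols"
  shows "lab j = lab j' \<longleftrightarrow> cs j \<inter> before l = cs j' \<inter> before l"
  using lab assms col_stack_take_eq_iff[of l j j'] l unfolding col_labeling_def by simp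

text \<open>Both multiplicities are constant over all columns, by \<open>card_same_trace\<close> for
  \<open>before l\<close> and for \<open>before l \<union> F\<close>. Hence the quotient is constant
  on every support.\<close>

lemma well_connected_B_C: "well_connected ncols [B, As ! l]"
proof -
  have B: "col_mult (stack ncols [B]) j = 2 ^ card (V - before l)" if "j < ncols" for j
  proof -
    have "col_mult (stack ncols [B]) j =
        card {j'. j' < ncols \<and> cs j' \<inter> before l = cs j \<inter> before l}"
      unfolding col_mult_def using that
      by (intro arg_cong[of _ _ card] Collect_cong)
        (simp add: col_stack_eq_iff dim_col_B_C col_B_eq_iff cong: conj_cong)
    then show ?thesis using that by (simp add: card_same_trace)
  qed
  have BC: "col_mult (stack ncols [B, As ! l]) j = 2 ^ card (V - (before l \<union> F))"
    if "j < ncols" for j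
  proof -
    have "col_mult (stack ncols [B, As ! l]) j =
        card {j'. j' < ncols \<and> cs j' \<inter> (before l \<union> F) = cs j \<inter> (before l \<union> F)}"
      unfolding col_mult_def using that
      by (intro arg_cong[of _ _ card] Collect_cong)
        (simp add: col_stack_eq_iff dim_col_B_C col_B_eq_iff col_nth_eq_iff[OF l]
          cong: conj_cong, blast)
    then show ?thesis using that by (simp only: card_same_trace)
  qed
  have "supp (As ! l) u \<subseteq> {..<ncols}" for u
    using dim_col_B_C by (auto simp: supp_def)
  then show ?thesis
    by (auto simp: well_connected_def less_Suc_eq B BC subset_iff)
qed

lemma ex_col_of_row_B:
  assumes "u < dim_row B" obtains j where "j < ncols" "lab j = u"
proof -
  have "u \<in> lab ` {..<ncols}"
    using lab assms unfolding col_labeling_def by simp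
  then show thesis using that by blast
qed

text \<open>Any column \<open>j\<close> labeled \<open>u\<close> represents the row, since all such
  columns share the trace on \<open>before l\<close>. A row of the next partition meets this one
  exactly when the two traces can be glued to one subset of \<open>V\<close>.\<close>

lemma connected_rows_B_C:
  assumes u: "u < dim_row B" and j: "j < ncols" "lab j = u"
  shows "connected_rows B (As ! l) u =
    {v. v < 2 ^ card F \<and> rs l v \<inter> before l = cs j \<inter> (before l \<inter> F)}"
    (is "?L = ?R")
proof
  show "?L \<subseteq> ?R"
  proof
    fix v assume v: "v \<in> ?L"
    then have v_row: "v < 2 ^ card F"
      by (simp add: connected_rows_def dim_row_C)
    from v u obtain j' where j': "j' < ncols" "lab j' = u" "cs j' \<inter> F = rs l v"
      using v_row
      by (auto simp: connected_rows_def supp_Cup_mat nth_As[OF l] supp_hierarchical_partition)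
    then have "cs j \<inter> before l = cs j' \<inter> before l"
      using j lab_eq_iff by blast
    then show "v \<in> ?R" using v_row j'(3) by blast
  qed
  show "?R \<subseteq> ?L"
  proof
    fix v assume "v \<in> ?R"
    then have v: "v < 2 ^ card F" "rs l v \<inter> before l = cs j \<inter> (before l \<inter> F)" by auto
    have vF: "rs l v \<subseteq> F" using rs_subset[OF l v(1)] .
    \<comment> \<open>The glued set: its two parts agree on \<open>before l \<inter> F\<close>, so
      it restricts to the first on \<open>before l\<close> and to the second on
      \<open>F\<close>.\<close>
    have "(cs j \<inter> before l) \<union> rs l v \<subseteq> V"
      using cs_subset[OF j(1)] vF facet_subset[OF l] by blast
    then obtain j' where j': "j' < ncols" "cs j' = (cs j \<inter> before l) \<union> rs l v"
      by (rule ex_col)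
    have "cs j' \<inter> before l = cs j \<inter> before l"
      unfolding j'(2) using v(2) by blast
    then have "lab j' = u" using lab_eq_iff j j'(1) by blast
    moreover have "cs j' \<inter> F = rs l v"
      unfolding j'(2) using v(2) vF by blast
    ultimately show "v \<in> ?L"
      using u v(1) j'(1)
      by (auto simp: connected_rows_def supp_Cup_mat nth_As[OF l] supp_hierarchical_partition)
  qed
qed

text \<open>The connected sets are fibers of the map sending \<open>v\<close> to
  \<open>rs l v \<inter> before l\<close>, hence disjoint or equal.\<close>

lemma floret_condition_B_C: "floret_condition B (As ! l)"
  unfolding floret_condition_def
proof (intro allI impI)
  fix u u' assume u: "u < dim_row B" and u': "u' < dim_row B"
  obtain j where j: "j < ncols" "lab j = u" using ex_col_of_row_B[OF u] .
  obtain j' where j': "j' < ncols" "lab j' = u'" using ex_col_of_row_B[OF u'] .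
  show "connected_rows B (As ! l) u \<inter> connected_rows B (As ! l) u' = {} \<or>
      connected_rows B (As ! l) u = connected_rows B (As ! l) u'"
    unfolding connected_rows_B_C[OF u j] connected_rows_B_C[OF u' j'] by auto
qed

lemma rows_Cap_mat_subset:
  assumes q: "q < l" "before l \<inter> F = Fs ! q \<inter> F"
    and fl: "floret_ordering B (As ! l) fl"
  shows "set (rows (Cap_mat (As ! l) fl)) \<subseteq> vec_space.row_space ncols (stack ncols (take l As))"
proof
  fix r assume "r \<in> set (rows (Cap_mat (As ! l) fl))"
  then obtain t where t: "t < length fl" and r: "r = row (Cap_mat (As ! l) fl) t"
    by (auto simp: rows_def Cap_mat_def)
  have "fl ! t \<in> florets B (As ! l)"
    using fl t by (metis floret_ordering_def nth_mem)
  then obtain u where u: "u < dim_row B" and flt: "fl ! t = connected_rows B (As ! l) u"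
    by (auto simp: florets_def)
  obtain j0 where j0: "j0 < ncols" "lab j0 = u" using ex_col_of_row_B[OF u] .
  \<comment> \<open>The row indices of the partition of \<open>Fs ! q\<close> that match the floret:
    by the assumption on \<open>q\<close>, the trace of a column on
    \<open>before l \<inter> F\<close> can be read off from its trace on
    \<open>Fs ! q\<close>.\<close>
  define \<S> where "\<S> = {S. S \<inter> F = cs j0 \<inter> (before l \<inter> F)}"
  have "(\<exists>v\<in>fl ! t. j \<in> supp (As ! l) v) \<longleftrightarrow> cs j \<inter> Fs ! q \<in> \<S>" if j: "j < ncols" for j
  proof -
    \<comment> \<open>Row \<open>w\<close> contains \<open>j\<close> in its support, and its index
      \<open>cs j \<inter> F\<close> is the only one possible for \<open>v\<close>, which eliminates
      the quantifier.\<close>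
    obtain w where w: "w < 2 ^ card F" "rs l w = cs j \<inter> F"
      using ex_row[OF l, of "cs j \<inter> F"] by blast
    have "(\<exists>v\<in>fl ! t. j \<in> supp (As ! l) v) \<longleftrightarrow>
        (\<exists>v<2 ^ card F. rs l v \<inter> before l = cs j0 \<inter> (before l \<inter> F) \<and> cs j \<inter> F = rs l v)"
      unfolding flt connected_rows_B_C[OF u j0]
      using j by (auto simp: nth_As[OF l] supp_hierarchical_partition)
    also have "\<dots> \<longleftrightarrow> (cs j \<inter> F) \<inter> before l = cs j0 \<inter> (before l \<inter> F)"
      using w by metis
    also have "(cs j \<inter> F) \<inter> before l = (cs j \<inter> Fs ! q) \<inter> F"
      using q(2) by blast
    finally show ?thesis by (simp add: \<S>_def)
  qed
  then have "r = vec ncols (\<lambda>j. if cs j \<inter> Fs ! q \<in> \<S> then 1 else 0)"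
    using t by (auto simp: r Cap_mat_def dim_col_B_C)
  then have "r \<in> vec_space.row_space ncols (As ! q)"
    using trace_in_row_space q(1) l by simp
  moreover have "As ! q \<in> set (take l As)"
    using q(1) l length_As by (auto simp: in_set_conv_nth intro!: exI[of _ q])
  ultimately show "r \<in> vec_space.row_space ncols (stack ncols (take l As))"
    using row_space_subset_stack[OF dim_col_take] by blast
qed

end

section \<open>From RIP to GRIP\<close>

lemma GRIP_if_RIP:
  assumes "RIP Fs"
  shows "GRIP ncols As"
proof -
  have "multipartition ncols As"
    using partition_matrix_nth length_As by (auto simp: multipartition_def in_set_conv_nth)
  moreover have "set (rows (Cap_mat (As ! l) fl)) \<subseteq>
      vec_space.row_space ncols (stack ncols (take l As))"
    if l: "1 \<le> l" "l < length Fs" and lab: "col_labeling (stack ncols (take l As)) lab"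
      and fl: "floret_ordering (Cup_mat (stack ncols (take l As)) lab) (As ! l) fl" for l lab fl
  proof -
    \<comment> \<open>RIP at \<open>r = l\<close> supplies the earlier facet for the row space
      condition; \<open>1 \<le> l\<close> puts \<open>l\<close> in its range.\<close>
    obtain q where "q < l" "before l \<inter> Fs ! l = Fs ! q \<inter> Fs ! l"
      using assms l unfolding RIP_def by meson
    then show ?thesis
      using rows_Cap_mat_subset[OF l(2) lab _ _ fl] by blast
  qed
  ultimately show ?thesis
    by (auto simp: GRIP_def Let_def length_As well_connected_B_C floret_condition_B_C)
qed

end

theorem proposition4p1:
  fixes V :: "'v set" and \<Gamma> :: "'v set set" and Fs :: "'v set list" and As :: "real mat list"
  assumes "finite V"
    and "simplicial_complex V \<Gamma>"
    and "facet_ordering \<Gamma> Fs"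
    and "RIP Fs"
    and "hierarchical_model V Fs As"
  shows "GRIP (2 ^ card V) As"
proof -
  have "set Fs \<subseteq> Pow V"
    using assms(2,3) by (auto simp: facet_ordering_def facets_def simplicial_complex_def)
  then have sub: "Fs ! i \<subseteq> V" if "i < length Fs" for i
    using that nth_mem by blast
  from assms(5) obtain cs where len: "length As = length Fs"
    and cs: "bij_betw cs {..<2 ^ card V} (Pow V)"
    and ex: "\<forall>i<length Fs. \<exists>rs. bij_betw rs {..<2 ^ card (Fs ! i)} (Pow (Fs ! i)) \<and>
          As ! i = hierarchical_partition V cs (Fs ! i) rs"
    unfolding hierarchical_model_def by blast
  \<comment> \<open>Choice merges the row enumerations, one per facet, into a single
    function.\<close>
  from ex obtain rs where
    "\<forall>i<length Fs. bij_betw (rs i) {..<2 ^ card (Fs ! i)} (Pow (Fs ! i)) \<and>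
          As ! i = hierarchical_partition V cs (Fs ! i) (rs i)"
    by metis
  then interpret indexed_hierarchical_model V Fs As cs rs
    using assms(1) sub len cs by unfold_locales auto
  show ?thesis using GRIP_if_RIP[OF assms(4)] .
qed

end
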